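(* Let $N\geq3$ and let $\mathbb H/\mathbb I$ be an amalgamation pattern. Every $N$-acyclic realisation of $\mathbb H/\mathbb I$ is $N$-universal.
   Context: **Conventions.** $\sigma$ is a finite relational signature; substructures are induced ($\mathcal A\restriction A_0$). A partial isomorphism from $\mathcal A$ to $\mathcal A'$ is a (possibly empty) partial map $p$ from $A$ to $A'$ that is an isomorphism $\mathcal A\restriction\mathrm{dom}(p)\simeq\mathcal A'\restriction\mathrm{image}(p)$. **Incidence and amalgamation patterns.** An incidence pattern $\mathbb I=(S,E,\iota,\cdot^{-1})$ is a finite two-sorted structure with sorts $S$ (sites) and $E$ (links), a map $\iota=(\iota_1,\iota_2)\colon E\to S^2$ and a map $e\mapsto e^{-1}$ on $E$ with $(e^{-1})^{-1}=e$ and $\iota_1(e^{-1})=\iota_2(e)$. An amalgamation pattern $\mathbb H/\mathbb I$ consists of $\mathbb I$, a $\sigma$-structure $\mathcal H$ with a map $\delta\colon H\to S$ such that $\mathcal H=\dot\bigcup_{s\in S}\mathcal A_s$ is the disjoint union of non-empty finite $\sigma$-structures $\mathcal A_s=\mathcal H\restriction\delta^{-1}(s)$ (universe $A_s$), and a family $(\rho_e)_{e\in E}$ of partial isomorphisms $\rho_e$ from $\mathcal A_{\iota_1(e)}$ to $\mathcal A_{\iota_2(e)}$ with $\rho_{e^{-1}}=\rho_e^{-1}$. A walk $w=e_1\cdots e_n$ in $\mathbb I$ satisfies $\iota_2(e_i)=\iota_1(e_{i+1})$; it leads from $\iota_1(e_1)$ to $\iota_2(e_n)$, and $\rho_w:=\rho_{e_n}\circ\cdots\circ\rho_{e_1}$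 (partial composition). The empty walk $\lambda_s$ from $s$ to $s$ has $\rho_{\lambda_s}=\mathrm{id}_{A_s}$. **Realisations.** An atlas $(\mathcal A,U,(U_s)_{s\in S},(\pi_{u,s})_{u\in U_s})$ for a $\sigma$-structure $\mathcal A$ with co-ordinate structures $(\mathcal A_s)_{s\in S}$ consists of a set $U=\bigcup_{s\in S}U_s$ of subsets $u\subseteq A$ (co-ordinate domains) and, for each $s\in S$ and $u\in U_s$, one chart $\pi_{u,s}$, an isomorphism $\pi_{u,s}\colon\mathcal A\restriction u\simeq\mathcal A_s$ (the sets $U_s$ need not be disjoint, so the same $u$ may carry charts into distinct co-ordinate structures); it is required that every element of $A$ and every tuple in every relation of $\mathcal A$ is contained in some $u\in U$. A realisation of $\mathbb H/\mathbb I$ is a $\sigma$-structure $\mathcal A$ with such an atlas, with $U_s\neq\emptyset$ for all $s\in S$, such that: (i) for every $u\in U_s$ and $e\in E$ with $\iota(e)=(s,s')$ there is some $u'\in U_{s'}$ such that $\mathrm{dom}(\rho_e)=\pi_{u,s}(u\cap u')$ and $\rho_e=\pi_{u',s'}\circ\pi_{u,s}^{-1}$ (partial composition); (ii) for any $u\in U_s$, $u'\in U_{s'}$ with $u\cap u'\neq\emptyset$ there is some walk $w$ in $\mathbb I$ such that $\mathrm{dom}(\rho_w)=\pi_{u,s}(u\cap u')$ and $\rho_w=\pi_{u',s'}\circ\pi_{u,s}^{-1}$. **Acyclicity.** A hypergraph $(A,U)$ consists of a vertex set $A$ and a set $U$ of finite non-empty subsets of $A$ (hyperedges) with $A=\bigcup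 U$. Its Gaifman graph links distinct $a,a'$ that lie in a common hyperedge. It is acyclic if its Gaifman graph has no chordless cycles of length greater than $3$ and every clique in the Gaifman graph is contained in some hyperedge. For $N\geq3$ it is $N$-acyclic if every induced sub-hypergraph (vertex set $A_0\subseteq A$, hyperedges the non-empty sets $u\cap A_0$, $u\in U$) with up to $N$ vertices is acyclic. A realisation is $N$-acyclic if the hypergraph $(A,U)$ of its co-ordinate domains is $N$-acyclic. **Universality.** A realisation of $\mathbb H/\mathbb I$ with $\sigma$-structure $\mathcal A$ is $N$-universal if every induced substructure of $\mathcal A$ of size up to $N$ can be homomorphically mapped into (the $\sigma$-structure of) any other (finite or infinite) realisation of $\mathbb H/\mathbb I$. *)

theory Defs
  imports Main
begin

section \<open>Relational signatures and structures\<close>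

text \<open>The symbols form a set, not a type, so that the empty signature is covered. Interpretations
  of names outside this set are never looked at. Tuples are lists.\<close>

record 'r signature =
  symbols :: "'r set"
  arity :: "'r \<Rightarrow> nat"

record ('r, 'a) rel_structure =
  universe :: "'a set"
  interp :: "'r \<Rightarrow> 'a list set"

definition finite_signature :: "'r signature \<Rightarrow> bool" where
  "finite_signature \<sigma> \<longleftrightarrow> finite (symbols \<sigma>)"

definition is_structure :: "'r signature \<Rightarrow> ('r, 'a) rel_structure \<Rightarrow> bool" where
  "is_structure \<sigma> A \<longleftrightarrow>
     (\<forall>r\<in>symbols \<sigma>. \<forall>t\<in>interp A r. length t = arity \<sigma> r \<and> set t \<subseteq> universe A)"

definition induced :: "('r, 'a) rel_structure \<Rightarrow> 'a set \<Rightarrow> ('r, 'a) rel_structure" where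
  "induced A X = \<lparr>universe = universe A \<inter> X, interp = (\<lambda>r. {t \<in> interp A r. set t \<subseteq> X})\<rparr>"

definition homomorphism ::
    "'r signature \<Rightarrow> ('a \<Rightarrow> 'b) \<Rightarrow> ('r, 'a) rel_structure \<Rightarrow> ('r, 'b) rel_structure \<Rightarrow> bool" where
  "homomorphism \<sigma> h A B \<longleftrightarrow>
     h ` universe A \<subseteq> universe B \<and>
     (\<forall>r\<in>symbols \<sigma>. \<forall>t\<in>interp A r. map h t \<in> interp B r)"

definition isomorphism ::
    "'r signature \<Rightarrow> ('a \<Rightarrow> 'b) \<Rightarrow> ('r, 'a) rel_structure \<Rightarrow> ('r, 'b) rel_structure \<Rightarrow> bool" where
  "isomorphism \<sigma> f A B \<longleftrightarrow>
     bij_betw f (universe A) (universe B) \<and>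
     (\<forall>r\<in>symbols \<sigma>. \<forall>t. length t = arity \<sigma> r \<and> set t \<subseteq> universe A \<longrightarrow>
        (t \<in> interp A r \<longleftrightarrow> map f t \<in> interp B r))"

definition partial_isomorphism ::
    "'r signature \<Rightarrow> ('a \<rightharpoonup> 'b) \<Rightarrow> ('r, 'a) rel_structure \<Rightarrow> ('r, 'b) rel_structure \<Rightarrow> bool" where
  "partial_isomorphism \<sigma> p A B \<longleftrightarrow>
     dom p \<subseteq> universe A \<and> ran p \<subseteq> universe B \<and>
     isomorphism \<sigma> (the \<circ> p) (induced A (dom p)) (induced B (ran p))"

text \<open>Inverse of a partial map, meaningful for injective ones.\<close>

definition partial_inverse :: "('a \<rightharpoonup> 'b) \<Rightarrow> ('b \<rightharpoonup> 'a)" where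
  "partial_inverse p = (\<lambda>b. if b \<in> ran p then Some (SOME a. p a = Some b) else None)"


section \<open>Incidence and amalgamation patterns\<close>

record ('s, 'e) incidence_pattern =
  sites :: "'s set"
  links :: "'e set"
  source :: "'e \<Rightarrow> 's"
  target :: "'e \<Rightarrow> 's"
  inv_link :: "'e \<Rightarrow> 'e"

definition is_incidence_pattern :: "('s, 'e) incidence_pattern \<Rightarrow> bool" where
  "is_incidence_pattern I \<longleftrightarrow>
     finite (sites I) \<and> finite (links I) \<and>
     (\<forall>e\<in>links I. source I e \<in> sites I \<and> target I e \<in> sites I \<and>
        inv_link I e \<in> links I \<and> inv_link I (inv_link I e) = e \<and>
        source I (inv_link I e) = target I e)"

record ('r, 'h, 's, 'e) amalgamation_pattern =
  incidence :: "('s, 'e) incidence_pattern"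
  total_structure :: "('r, 'h) rel_structure"
  site_of :: "'h \<Rightarrow> 's"
  transition :: "'e \<Rightarrow> ('h \<rightharpoonup> 'h)"

definition site_structure ::
    "('r, 'h, 's, 'e) amalgamation_pattern \<Rightarrow> 's \<Rightarrow> ('r, 'h) rel_structure" where
  "site_structure P s = induced (total_structure P) {x. site_of P x = s}"

definition is_amalgamation_pattern ::
    "'r signature \<Rightarrow> ('r, 'h, 's, 'e) amalgamation_pattern \<Rightarrow> bool" where
  "is_amalgamation_pattern \<sigma> P \<longleftrightarrow>
     is_incidence_pattern (incidence P) \<and>
     is_structure \<sigma> (total_structure P) \<and>
     site_of P ` universe (total_structure P) \<subseteq> sites (incidence P) \<and>
     universe (total_structure P) = (\<Union>s\<in>sites (incidence P). universe (site_structure P s)) \<and>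
     (\<forall>r\<in>symbols \<sigma>. interp (total_structure P) r =
        (\<Union>s\<in>sites (incidence P). interp (site_structure P s) r)) \<and>
     (\<forall>s\<in>sites (incidence P).
        universe (site_structure P s) \<noteq> {} \<and> finite (universe (site_structure P s))) \<and>
     (\<forall>e\<in>links (incidence P).
        partial_isomorphism \<sigma> (transition P e)
          (site_structure P (source (incidence P) e))
          (site_structure P (target (incidence P) e)) \<and>
        transition P (inv_link (incidence P) e) = partial_inverse (transition P e))"

text \<open>\<open>walk I s w s'\<close>: the list of links \<open>w\<close> is a walk leading from \<open>s\<close> to \<open>s'\<close>; the empty list is
  the empty walk at each site.\<close>

fun walk :: "('s, 'e) incidence_pattern \<Rightarrow> 's \<Rightarrow> 'e list \<Rightarrow> 's \<Rightarrow> bool" where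
  "walk I s [] s' \<longleftrightarrow> s \<in> sites I \<and> s' = s"
| "walk I s (e # w) s' \<longleftrightarrow> e \<in> links I \<and> source I e = s \<and> walk I (target I e) w s'"

text \<open>The partial map of a walk starting at the given site. The innermost call contributes the
  identity of the last site structure, which does not change the composition of a non-empty walk.\<close>

fun walk_map :: "('r, 'h, 's, 'e) amalgamation_pattern \<Rightarrow> 's \<Rightarrow> 'e list \<Rightarrow> ('h \<rightharpoonup> 'h)" where
  "walk_map P s [] = Some |` universe (site_structure P s)"
| "walk_map P s (e # w) = walk_map P (target (incidence P) e) w \<circ>\<^sub>m transition P e"


section \<open>Atlases and realisations\<close>

text \<open>The chart of a co-ordinate domain \<open>u\<close> at a site \<open>s\<close> is a partial map with domain \<open>u\<close>; it is
  only relevant if \<open>u\<close> is one of the co-ordinate domains at \<open>s\<close>.\<close>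

record ('r, 'a, 's, 'h) atlas =
  atlas_structure :: "('r, 'a) rel_structure"
  domains :: "'s \<Rightarrow> 'a set set"
  chart :: "'s \<Rightarrow> 'a set \<Rightarrow> ('a \<rightharpoonup> 'h)"

definition all_domains :: "'s set \<Rightarrow> ('r, 'a, 's, 'h) atlas \<Rightarrow> 'a set set" where
  "all_domains S \<A> = (\<Union>s\<in>S. domains \<A> s)"

definition is_atlas ::
    "'r signature \<Rightarrow> 's set \<Rightarrow> ('s \<Rightarrow> ('r, 'h) rel_structure) \<Rightarrow> ('r, 'a, 's, 'h) atlas \<Rightarrow> bool" where
  "is_atlas \<sigma> S C \<A> \<longleftrightarrow>
     is_structure \<sigma> (atlas_structure \<A>) \<and>
     (\<forall>s\<in>S. \<forall>u\<in>domains \<A> s.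
        u \<subseteq> universe (atlas_structure \<A>) \<and>
        dom (chart \<A> s u) = u \<and>
        isomorphism \<sigma> (the \<circ> chart \<A> s u) (induced (atlas_structure \<A>) u) (C s)) \<and>
     (\<forall>a\<in>universe (atlas_structure \<A>). \<exists>u\<in>all_domains S \<A>. a \<in> u) \<and>
     (\<forall>r\<in>symbols \<sigma>. \<forall>t\<in>interp (atlas_structure \<A>) r. \<exists>u\<in>all_domains S \<A>. set t \<subseteq> u)"

definition chart_change_is ::
    "('r, 'a, 's, 'h) atlas \<Rightarrow> 's \<Rightarrow> 'a set \<Rightarrow> 's \<Rightarrow> 'a set \<Rightarrow> ('h \<rightharpoonup> 'h) \<Rightarrow> bool" where
  "chart_change_is \<A> s u s' u' p \<longleftrightarrow>
     dom p = (the \<circ> chart \<A> s u) ` (u \<inter> u') \<and>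
     p = chart \<A> s' u' \<circ>\<^sub>m partial_inverse (chart \<A> s u)"

definition is_realisation ::
    "'r signature \<Rightarrow> ('r, 'h, 's, 'e) amalgamation_pattern \<Rightarrow> ('r, 'a, 's, 'h) atlas \<Rightarrow> bool" where
  "is_realisation \<sigma> P \<A> \<longleftrightarrow>
     is_atlas \<sigma> (sites (incidence P)) (site_structure P) \<A> \<and>
     (\<forall>s\<in>sites (incidence P). domains \<A> s \<noteq> {}) \<and>
     (\<forall>s\<in>sites (incidence P). \<forall>s'\<in>sites (incidence P). \<forall>u\<in>domains \<A> s. \<forall>e\<in>links (incidence P).
        source (incidence P) e = s \<and> target (incidence P) e = s' \<longrightarrow>
        (\<exists>u'\<in>domains \<A> s'. chart_change_is \<A> s u s' u' (transition P e))) \<and>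
     (\<forall>s\<in>sites (incidence P). \<forall>s'\<in>sites (incidence P). \<forall>u\<in>domains \<A> s. \<forall>u'\<in>domains \<A> s'.
        u \<inter> u' \<noteq> {} \<longrightarrow>
        (\<exists>w. walk (incidence P) s w s' \<and> chart_change_is \<A> s u s' u' (walk_map P s w)))"


section \<open>Acyclicity\<close>

definition is_hypergraph :: "'a set \<Rightarrow> 'a set set \<Rightarrow> bool" where
  "is_hypergraph V U \<longleftrightarrow> (\<forall>u\<in>U. finite u \<and> u \<noteq> {}) \<and> V = \<Union>U"

definition gaifman :: "'a set set \<Rightarrow> 'a \<Rightarrow> 'a \<Rightarrow> bool" where
  "gaifman U a b \<longleftrightarrow> a \<noteq> b \<and> (\<exists>u\<in>U. a \<in> u \<and> b \<in> u)"

definition graph_cycle :: "'a set \<Rightarrow> ('a \<Rightarrow> 'a \<Rightarrow> bool) \<Rightarrow> 'a list \<Rightarrow> bool" where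
  "graph_cycle V adj c \<longleftrightarrow>
     3 \<le> length c \<and> distinct c \<and> set c \<subseteq> V \<and>
     (\<forall>i<length c. adj (c ! i) (c ! (Suc i mod length c)))"

definition chordless :: "('a \<Rightarrow> 'a \<Rightarrow> bool) \<Rightarrow> 'a list \<Rightarrow> bool" where
  "chordless adj c \<longleftrightarrow>
     (\<forall>i<length c. \<forall>j<length c. adj (c ! i) (c ! j) \<longrightarrow>
        j = Suc i mod length c \<or> i = Suc j mod length c)"

definition clique :: "'a set \<Rightarrow> ('a \<Rightarrow> 'a \<Rightarrow> bool) \<Rightarrow> 'a set \<Rightarrow> bool" where
  "clique V adj K \<longleftrightarrow> K \<subseteq> V \<and> (\<forall>a\<in>K. \<forall>b\<in>K. a \<noteq> b \<longrightarrow> adj a b)"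

text \<open>Only non-empty cliques are required to be covered: otherwise the hypergraph without vertices,
  which has no hyperedges, would fail to be acyclic, and so no hypergraph would be \<open>N\<close>-acyclic.\<close>

definition acyclic_hypergraph :: "'a set \<Rightarrow> 'a set set \<Rightarrow> bool" where
  "acyclic_hypergraph V U \<longleftrightarrow>
     is_hypergraph V U \<and>
     \<not> (\<exists>c. graph_cycle V (gaifman U) c \<and> chordless (gaifman U) c \<and> 3 < length c) \<and>
     (\<forall>K. clique V (gaifman U) K \<and> K \<noteq> {} \<longrightarrow> (\<exists>u\<in>U. K \<subseteq> u))"

definition induced_hyperedges :: "'a set set \<Rightarrow> 'a set \<Rightarrow> 'a set set" where
  "induced_hyperedges U X = {u \<inter> X | u. u \<in> U \<and> u \<inter> X \<noteq> {}}"

definition N_acyclic_hypergraph :: "nat \<Rightarrow> 'a set \<Rightarrow> 'a set set \<Rightarrow> bool" where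
  "N_acyclic_hypergraph N V U \<longleftrightarrow>
     is_hypergraph V U \<and>
     (\<forall>X. X \<subseteq> V \<and> finite X \<and> card X \<le> N \<longrightarrow> acyclic_hypergraph X (induced_hyperedges U X))"

definition N_acyclic_realisation ::
    "nat \<Rightarrow> 'r signature \<Rightarrow> ('r, 'h, 's, 'e) amalgamation_pattern \<Rightarrow> ('r, 'a, 's, 'h) atlas \<Rightarrow> bool" where
  "N_acyclic_realisation N \<sigma> P \<A> \<longleftrightarrow>
     is_realisation \<sigma> P \<A> \<and>
     N_acyclic_hypergraph N (universe (atlas_structure \<A>)) (all_domains (sites (incidence P)) \<A>)"


section \<open>Universality\<close>

text \<open>The type argument is the type of elements of the other realisations. A theorem in which it is
  an arbitrary type variable speaks about realisations of every cardinality.\<close>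

definition N_universal_realisation ::
    "'b itself \<Rightarrow> nat \<Rightarrow> 'r signature \<Rightarrow> ('r, 'h, 's, 'e) amalgamation_pattern \<Rightarrow>
     ('r, 'a, 's, 'h) atlas \<Rightarrow> bool" where
  "N_universal_realisation _ N \<sigma> P \<A> \<longleftrightarrow>
     is_realisation \<sigma> P \<A> \<and>
     (\<forall>X. X \<subseteq> universe (atlas_structure \<A>) \<and> finite X \<and> card X \<le> N \<longrightarrow>
        (\<forall>\<B> :: ('r, 'b, 's, 'h) atlas. is_realisation \<sigma> P \<B> \<longrightarrow>
           (\<exists>h. homomorphism \<sigma> h (induced (atlas_structure \<A>) X) (atlas_structure \<B>))))"

end

theory Submission
  imports Defs
begin

text \<open>
  Let \<open>X\<close> be a set of at most \<open>N\<close> elements of the acyclic realisation \<open>\<A>\<close>, and let \<open>\<B>\<close> be any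
  realisation. Call a map from \<open>X\<close> into \<open>\<B>\<close> chart-compatible if its restriction to the trace of
  each co-ordinate domain of \<open>\<A>\<close> maps into some co-ordinate domain of \<open>\<B>\<close> at the same site and
  is the identity when read in the two charts. Charts are isomorphisms and every related tuple lies
  in a co-ordinate domain, so chart-compatible maps are homomorphisms (\<open>chart_compatible_homomorphism\<close>).

  Chart-compatible maps are built one vertex at a time. By Dirac's theorem
  (\<open>chordal_simplicial_exists\<close>) the Gaifman graph on \<open>X\<close>, being chordal, has a vertex \<open>x\<close> whose
  closed neighbourhood is a clique; by conformality some co-ordinate domain \<open>u\<^sub>0\<close> contains this
  clique. A map that is compatible on \<open>X - {x}\<close> sends the rest of \<open>u\<^sub>0 \<inter> X\<close> into some co-ordinate
  domain \<open>v\<^sub>0\<close> of \<open>\<B>\<close>, and the charts of \<open>u\<^sub>0\<close> and \<open>v\<^sub>0\<close> dictate the image of \<open>x\<close>. Every other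
  domain \<open>u\<close> through \<open>x\<close> has \<open>u \<inter> X \<subseteq> u\<^sub>0\<close>. The change of charts from \<open>u\<^sub>0\<close> to \<open>u\<close> is described by a
  walk in the incidence pattern, and following that walk in \<open>\<B>\<close> from \<open>v\<^sub>0\<close>
  (\<open>walk_followed_in_realisation\<close>) leads to a domain that serves \<open>u\<close>. Domains of \<open>\<B>\<close> may overlap
  in more points than the walk accounts for, so that points of \<open>X\<close> may become identified or newly
  related in \<open>\<B>\<close>; this is why the result is a homomorphism and not an embedding.
\<close>


section \<open>Simplicial vertices of chordal graphs\<close>

definition chordal :: "'a set \<Rightarrow> ('a \<Rightarrow> 'a \<Rightarrow> bool) \<Rightarrow> bool" where
  "chordal V adj \<longleftrightarrow> (\<nexists>c. graph_cycle V adj c \<and> chordless adj c \<and> 3 < length c)"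

definition simplicial :: "'a set \<Rightarrow> ('a \<Rightarrow> 'a \<Rightarrow> bool) \<Rightarrow> 'a \<Rightarrow> bool" where
  "simplicial V adj a \<longleftrightarrow> a \<in> V \<and> clique V adj {b \<in> V. b = a \<or> adj a b}"

definition path_in :: "'a set \<Rightarrow> ('a \<Rightarrow> 'a \<Rightarrow> bool) \<Rightarrow> 'a \<Rightarrow> 'a list \<Rightarrow> 'a \<Rightarrow> bool" where
  "path_in W adj x p y \<longleftrightarrow>
     p \<noteq> [] \<and> hd p = x \<and> last p = y \<and> set p \<subseteq> W \<and> successively adj p"

lemma chordal_subset: "chordal V adj \<Longrightarrow> W \<subseteq> V \<Longrightarrow> chordal W adj"
  unfolding chordal_def graph_cycle_def by blast

lemma rtranclp_path_in:
  assumes "(\<lambda>a b. adj a b \<and> a \<in> R \<and> b \<in> R)\<^sup>*\<^sup>* a b" "a \<in> R"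
  shows "\<exists>p. path_in R adj a p b"
  using assms
proof (induction rule: rtranclp_induct)
  case base
  then have "path_in R adj a [a] a" by (simp add: path_in_def)
  then show ?case by blast
next
  case (step y z)
  then obtain p where "path_in R adj a p y" by blast
  with step have "path_in R adj a (p @ [z]) z"
    by (auto simp: path_in_def successively_append_iff)
  then show ?case by blast
qed

lemma shortest_path_distinct:
  assumes p: "path_in W adj x p y"
    and shortest: "\<And>q. path_in W adj x q y \<Longrightarrow> length p \<le> length q"
  shows "distinct p"
proof (rule ccontr)
  assume "\<not> distinct p"
  then obtain xs ys zs a where dec: "p = xs @ [a] @ ys @ [a] @ zs"
    using not_distinct_decomp by blast
  have "path_in W adj x (xs @ [a] @ zs) y"
    using p unfolding dec path_in_def
    by (auto simp: successively_append_iff successively_Cons hd_append split: if_splits)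
  from shortest[OF this] show False by (simp add: dec)
qed

lemma shortest_path_no_shortcut:
  assumes p: "path_in W adj x p y"
    and shortest: "\<And>q. path_in W adj x q y \<Longrightarrow> length p \<le> length q"
    and ij: "i < j" "j < length p" and adj: "adj (p ! i) (p ! j)"
  shows "j = Suc i"
proof -
  define q where "q = take (Suc i) p @ drop j p"
  have ne: "take (Suc i) p \<noteq> []" "drop j p \<noteq> []" using ij by auto
  have last_take: "last (take (Suc i) p) = p ! i"
    using ij by (simp add: take_Suc_conv_app_nth)
  have hd_drop: "hd (drop j p) = p ! j" using ij by (simp add: hd_drop_conv_nth)
  have succ: "successively adj (take (Suc i) p @ drop (Suc i) p)"
    "successively adj (take j p @ drop j p)"
    using p by (simp_all only: append_take_drop_id path_in_def)
  have "successively adj q"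
    unfolding q_def using succ ne last_take hd_drop adj by (simp only: successively_append_iff) simp
  moreover have "hd q = x" "last q = y"
    using p ij ne by (auto simp: q_def path_in_def)
  moreover have "set q \<subseteq> W"
    using p set_take_subset[of "Suc i" p] set_drop_subset[of j p] unfolding q_def path_in_def by auto
  ultimately have "path_in W adj x q y" using ne by (simp add: path_in_def q_def)
  from shortest[OF this] show ?thesis using ij by (simp add: q_def)
qed

text \<open>A shortest path from \<open>x\<close> to \<open>y\<close> through \<open>R\<close> is induced, so if \<open>x\<close> and \<open>y\<close> were not adjacent
  it would close up with \<open>v\<close> to a chordless cycle of length at least four.\<close>

lemma chordal_linked_neighbours_adjacent:
  assumes chordal: "chordal V adj" and sym: "\<And>a b. adj a b \<Longrightarrow> adj b a"
    and V: "v \<in> V" "x \<in> V" "y \<in> V" "R \<subseteq> V" and vR: "v \<notin> R" "\<And>r. r \<in> R \<Longrightarrow> \<not> adj v r"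
    and irrefl: "\<And>a. \<not> adj a a"
    and vx: "adj v x" and vy: "adj v y" and xy: "x \<noteq> y"
    and path: "path_in (R \<union> {x, y}) adj x p\<^sub>0 y"
  shows "adj x y"
proof (rule ccontr)
  assume nadj: "\<not> adj x y"
  let ?W = "R \<union> {x, y}"
  obtain p where p: "path_in ?W adj x p y"
    and shortest: "\<And>q. path_in ?W adj x q y \<Longrightarrow> length p \<le> length q"
    using ex_has_least_nat[of "\<lambda>p. path_in ?W adj x p y" p\<^sub>0 length] path by blast
  note dist = shortest_path_distinct[OF p shortest]
  note no_shortcut = shortest_path_no_shortcut[OF p shortest]
  have ne: "p \<noteq> []" and succ: "successively adj p" and pW: "set p \<subseteq> ?W"
    using p by (auto simp: path_in_def)
  have p_first: "p ! 0 = x" and p_last: "p ! (length p - 1) = y"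
    using p by (auto simp: path_in_def hd_conv_nth last_conv_nth)
  have len: "3 \<le> length p"
  proof (rule ccontr)
    assume "\<not> 3 \<le> length p"
    moreover have "length p \<noteq> 0" using ne by simp
    ultimately have "length p = 1 \<or> length p = 2" by linarith
    then show False
    proof
      assume "length p = 1" with p_first p_last xy show False by simp
    next
      assume l: "length p = 2"
      with succ have "adj (p ! 0) (p ! 1)" by (simp add: successively_conv_nth)
      with l p_first p_last nadj show False by simp
    qed
  qed
  have v_adj: "k = 0 \<or> k = length p - 1" if "adj v (p ! k)" "k < length p" for k
  proof -
    have "p ! k \<in> ?W" using pW nth_mem[OF that(2)] by blast
    with vR that(1) have "p ! k = x \<or> p ! k = y" by blast
    moreover have "0 < length p" "length p - 1 < length p" using len by auto
    ultimately show ?thesis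
      using p_first p_last that(2) nth_eq_iff_index_eq[OF dist that(2)] by metis
  qed
  let ?c = "v # p"
  have "v \<notin> set p" using vR pW vx vy irrefl by auto
  moreover have "adj (?c ! i) (?c ! (Suc i mod length ?c))" if i: "i < length ?c" for i
  proof (cases i)
    case 0 then show ?thesis using ne p_first vx by simp
  next
    case (Suc k)
    show ?thesis
    proof (cases "Suc k = length p")
      case True
      then have "?c ! i = y" "Suc i mod length ?c = 0"
        using p_last Suc by (simp_all add: True[symmetric])
      then show ?thesis using sym[OF vy] by simp
    next
      case False
      then show ?thesis using Suc i succ by (simp add: successively_conv_nth)
    qed
  qed
  ultimately have cycle: "graph_cycle V adj ?c"
    using dist len pW V unfolding graph_cycle_def by auto
  have ordered: "j = Suc i mod length ?c \<or> i = Suc j mod length ?c"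
    if "i < j" "j < length ?c" "adj (?c ! i) (?c ! j)" for i j
  proof (cases i)
    case 0
    with that obtain k where "j = Suc k" "k < length p" "adj v (p ! k)" by (cases j) auto
    with v_adj[of k] 0 ne show ?thesis by auto
  next
    case (Suc k)
    with that obtain l where l: "j = Suc l" by (cases j) auto
    with no_shortcut[of k l] Suc that show ?thesis by auto
  qed
  have "chordless adj ?c"
    unfolding chordless_def
  proof (intro allI impI)
    fix i j
    assume ij: "i < length ?c" "j < length ?c" "adj (?c ! i) (?c ! j)"
    then consider "i < j" | "j < i" using irrefl by (metis nat_neq_iff)
    then show "j = Suc i mod length ?c \<or> i = Suc j mod length ?c"
      using ordered[of i j] ordered[of j i] ij sym[OF ij(3)] by cases blast+
  qed
  with cycle chordal len show False unfolding chordal_def by auto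
qed

text \<open>If \<open>a \<in> W\<close> has all its neighbours in \<open>W\<close>, its neighbourhoods in \<open>W\<close> and in \<open>V\<close> coincide.\<close>

lemma simplicial_superset:
  assumes "simplicial W adj a" "W \<subseteq> V" "\<And>b. b \<in> V \<Longrightarrow> adj a b \<Longrightarrow> b \<in> W"
  shows "simplicial V adj a"
  using assms unfolding simplicial_def clique_def by blast

text \<open>The assertion that a suitable simplicial vertex can be found away from a prescribed vertex \<open>v\<close>
  is what makes the induction for Dirac's theorem work. Let \<open>C\<close> be a connected component of the
  vertices that are neither equal nor adjacent to \<open>v\<close>. The neighbours \<open>S\<close> of \<open>C\<close> outside it
  are all adjacent to \<open>v\<close>, and any two of them are linked through \<open>C\<close>; hence \<open>S\<close> is a clique. A simplicial vertex of the
  smaller graph on \<open>C \<union> S\<close> that lies in \<open>C\<close> is simplicial in the whole graph; it is found by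
  prescribing some \<open>s \<in> S\<close> that is not adjacent to all of \<open>C \<union> S\<close>, or in the graph on \<open>C\<close> alone if
  there is no such \<open>s\<close>.\<close>

lemma chordal_simplicial_far_from:
  assumes "finite V" "chordal V adj" and sym: "\<And>a b. adj a b \<Longrightarrow> adj b a"
    and irrefl: "\<And>a. \<not> adj a a"
    and "v \<in> V" "w \<in> V" "w \<noteq> v" "\<not> adj v w"
  shows "\<exists>a. simplicial V adj a \<and> a \<noteq> v \<and> \<not> adj v a"
  using assms(1,2,5-)
proof (induction V arbitrary: v w rule: finite_psubset_induct)
  case (psubset V)
  define R where "R = {z \<in> V. z \<noteq> v \<and> \<not> adj v z}"
  define step where "step = (\<lambda>a b. adj a b \<and> a \<in> R \<and> b \<in> R)"
  define C where "C = {a. step\<^sup>*\<^sup>* w a}"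
  define S where "S = {s \<in> V - C. \<exists>a\<in>C. adj a s}"
  have wR: "w \<in> R" using psubset.prems by (simp add: R_def)
  have CR: "C \<subseteq> R"
  proof
    fix a assume "a \<in> C"
    then have "step\<^sup>*\<^sup>* w a" by (simp add: C_def)
    then show "a \<in> R" by (induction rule: rtranclp_induct) (auto simp: wR step_def)
  qed
  have wC: "w \<in> C" by (simp add: C_def)
  have C_closed: "b \<in> C" if "a \<in> C" "b \<in> R" "adj a b" for a b
  proof -
    have "step a b" using that CR by (auto simp: step_def)
    with that(1) show ?thesis unfolding C_def by (auto intro: rtranclp.rtrancl_into_rtrancl)
  qed
  have symp_step: "symp step" using sym by (auto simp: symp_def step_def)
  have C_connected: "step\<^sup>*\<^sup>* a b" if "a \<in> C" "b \<in> C" for a b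
  proof -
    from that have "step\<^sup>*\<^sup>* w a" "step\<^sup>*\<^sup>* w b" by (auto simp: C_def)
    with sympD[OF symp_rtranclp[OF symp_step]] show ?thesis by (meson rtranclp_trans)
  qed
  have S_adj: "adj v s" if "s \<in> S" for s
  proof -
    from that obtain a where a: "a \<in> C" "adj a s" "s \<in> V" "s \<notin> C" by (auto simp: S_def)
    then have "s \<notin> R" using C_closed by blast
    moreover have "s \<noteq> v" using a CR sym[OF a(2)] by (auto simp: R_def)
    ultimately show ?thesis using a by (auto simp: R_def)
  qed
  have S_clique: "adj x y" if x: "x \<in> S" and y: "y \<in> S" and xy: "x \<noteq> y" for x y
  proof -
    from x y obtain a b where a: "a \<in> C" "adj a x" and b: "b \<in> C" "adj b y"
      by (auto simp: S_def)
    obtain q where q: "path_in R adj a q b"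
      using rtranclp_path_in[of adj R a b] C_connected[OF a(1) b(1)] a(1) CR
      by (auto simp: step_def)
    have "path_in (R \<union> {x, y}) adj x (x # q @ [y]) y"
      using q sym[OF a(2)] b(2) by (auto simp: path_in_def successively_Cons successively_append_iff)
    moreover have "x \<in> V" "y \<in> V" using x y by (auto simp: S_def)
    ultimately show ?thesis
      using psubset.prems(2) S_adj[OF x] S_adj[OF y] xy irrefl
      by (intro chordal_linked_neighbours_adjacent[of V adj v x y R, OF psubset.prems(1) sym])
        (auto simp: R_def)
  qed
  have CV: "C \<subseteq> V" and vC: "v \<notin> C" using CR by (auto simp: R_def)
  have vCS: "v \<notin> C \<union> S" using vC S_adj irrefl by auto
  then have CS: "C \<union> S \<subset> V" and C: "C \<subset> V" using CV psubset.prems by (auto simp: S_def)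
  have chordal_CS: "chordal (C \<union> S) adj" and chordal_C: "chordal C adj"
    using chordal_subset[OF psubset.prems(1)] CS C by (auto simp del: Un_subset_iff)
  have lift: ?case if "simplicial (C \<union> S) adj a" "a \<in> C" for a
  proof -
    have "simplicial V adj a"
      by (rule simplicial_superset[OF that(1)]) (use CS that(2) in \<open>auto simp: S_def\<close>)
    moreover have "a \<noteq> v" "\<not> adj v a" using that(2) CR by (auto simp: R_def)
    ultimately show ?thesis by blast
  qed
  show ?case
  proof (cases "\<exists>s\<in>S. \<exists>b\<in>C \<union> S. b \<noteq> s \<and> \<not> adj s b")
    case True
    then obtain s b where "s \<in> S" "b \<in> C \<union> S" "b \<noteq> s" "\<not> adj s b" by blast
    then obtain a where a: "simplicial (C \<union> S) adj a" "a \<noteq> s" "\<not> adj s a"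
      using psubset.IH[OF CS chordal_CS, of s b] by blast
    then have "a \<in> C" using S_clique \<open>s \<in> S\<close> by (auto simp: simplicial_def)
    with a show ?thesis using lift by blast
  next
    case False
    \<comment> \<open>Every vertex of \<open>S\<close> is now adjacent to all of \<open>C \<union> S\<close>, so only \<open>C\<close> matters.\<close>
    have "\<exists>a. simplicial C adj a"
    proof (cases "\<exists>a\<in>C. \<exists>b\<in>C. b \<noteq> a \<and> \<not> adj a b")
      case True
      then obtain c b where "c \<in> C" "b \<in> C" "b \<noteq> c" "\<not> adj c b" by blast
      then show ?thesis using psubset.IH[OF C chordal_C, of c b] by blast
    next
      case False
      then have "adj a b" if "a \<in> C" "b \<in> C" "a \<noteq> b" for a b using that by metis
      then have "clique C adj {b \<in> C. b = w \<or> adj w b}" unfolding clique_def by blast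
      with wC have "simplicial C adj w" by (simp add: simplicial_def)
      then show ?thesis by blast
    qed
    then obtain a where a: "simplicial C adj a" by blast
    have universal: "adj s b" if "s \<in> S" "b \<in> C \<union> S" "b \<noteq> s" for s b
      using False that by blast
    have "adj b c" if "b \<in> C \<union> S" "c \<in> C \<union> S" "b \<noteq> c" "b = a \<or> adj a b" "c = a \<or> adj a c"
      for b c
    proof (cases "b \<in> S \<or> c \<in> S")
      case True
      then show ?thesis using universal[of b c] universal[of c b] sym[of c b] that(1-3) by auto
    next
      case False
      with a that show ?thesis unfolding simplicial_def clique_def by blast
    qed
    then have "clique (C \<union> S) adj {b \<in> C \<union> S. b = a \<or> adj a b}"
      unfolding clique_def by blast
    then have "simplicial (C \<union> S) adj a" using a by (simp add: simplicial_def)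
    moreover have "a \<in> C" using a by (simp add: simplicial_def)
    ultimately show ?thesis by (rule lift)
  qed
qed

lemma chordal_simplicial_exists:
  assumes "finite V" "V \<noteq> {}" "chordal V adj" and "\<And>a b. adj a b \<Longrightarrow> adj b a"
    and "\<And>a. \<not> adj a a"
  shows "\<exists>a. simplicial V adj a"
proof (cases "\<exists>a\<in>V. \<exists>b\<in>V. b \<noteq> a \<and> \<not> adj a b")
  case True
  then show ?thesis using chordal_simplicial_far_from[OF assms(1,3,4,5)] by blast
next
  case False
  then have "adj a b" if "a \<in> V" "b \<in> V" "a \<noteq> b" for a b using that by metis
  then have "clique V adj {b \<in> V. b = a \<or> adj a b}" for a unfolding clique_def by blast
  moreover obtain a where "a \<in> V" using assms(2) by blast
  ultimately have "simplicial V adj a" by (simp add: simplicial_def)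
  then show ?thesis by blast
qed


section \<open>Acyclic hypergraphs\<close>

lemma gaifman_induced_hyperedges:
  "gaifman (induced_hyperedges U X) a b \<longleftrightarrow> gaifman U a b \<and> a \<in> X \<and> b \<in> X"
  by (auto simp: gaifman_def induced_hyperedges_def)

text \<open>This is the step of the GYO reduction: a closed neighbourhood that is a clique lies in a
  single hyperedge, which then absorbs the traces of all hyperedges through that vertex.\<close>

lemma acyclic_hypergraph_ear:
  assumes acyclic: "acyclic_hypergraph X (induced_hyperedges U X)" and "finite X" "X \<noteq> {}"
  shows "\<exists>x\<in>X. \<exists>u\<^sub>0\<in>U. x \<in> u\<^sub>0 \<and> (\<forall>u\<in>U. x \<in> u \<longrightarrow> u \<inter> X \<subseteq> u\<^sub>0)"
proof -
  let ?U = "induced_hyperedges U X"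
  have "chordal X (gaifman ?U)"
    using acyclic by (auto simp: acyclic_hypergraph_def chordal_def)
  then obtain x where x: "simplicial X (gaifman ?U) x"
    using chordal_simplicial_exists[OF assms(2,3), of "gaifman ?U"] by (auto simp: gaifman_def)
  let ?K = "{b \<in> X. b = x \<or> gaifman ?U x b}"
  have xX: "x \<in> X" and "clique X (gaifman ?U) ?K" using x by (auto simp: simplicial_def)
  then obtain u' where "u' \<in> ?U" "?K \<subseteq> u'"
    using acyclic unfolding acyclic_hypergraph_def by blast
  then obtain u\<^sub>0 where u\<^sub>0: "u\<^sub>0 \<in> U" "?K \<subseteq> u\<^sub>0" by (auto simp: induced_hyperedges_def)
  have "u \<inter> X \<subseteq> u\<^sub>0" if "u \<in> U" "x \<in> u" for u
  proof -
    have "u \<inter> X \<subseteq> ?K"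
      using that xX by (auto simp: gaifman_induced_hyperedges) (auto simp: gaifman_def)
    with u\<^sub>0 show ?thesis by blast
  qed
  then show ?thesis using u\<^sub>0 xX by blast
qed


section \<open>Following walks in realisations\<close>

lemma partial_inverse_Some_iff:
  assumes "inj_on p (dom p)"
  shows "partial_inverse p b = Some a \<longleftrightarrow> p a = Some b"
proof
  assume "partial_inverse p b = Some a"
  then have "b \<in> ran p" "a = (SOME a. p a = Some b)"
    by (auto simp: partial_inverse_def split: if_splits)
  then show "p a = Some b" by (auto simp: ran_def intro: someI)
next
  assume a: "p a = Some b"
  have "(SOME a. p a = Some b) = a"
  proof (rule some_equality[where a = a])
    show "p a = Some b" by (fact a)
    show "a' = a" if "p a' = Some b" for a'
      using inj_onD[OF assms, of a' a] a that by (simp add: dom_def)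
  qed
  then show "partial_inverse p b = Some a" using a by (auto simp: partial_inverse_def ran_def)
qed

lemma atlas_covers:
  assumes "is_atlas \<sigma> S F \<A>"
  shows "a \<in> universe (atlas_structure \<A>) \<Longrightarrow> \<exists>s\<in>S. \<exists>u\<in>domains \<A> s. a \<in> u"
    and "r \<in> symbols \<sigma> \<Longrightarrow> t \<in> interp (atlas_structure \<A>) r \<Longrightarrow> \<exists>s\<in>S. \<exists>u\<in>domains \<A> s. set t \<subseteq> u"
  using assms by (simp_all add: is_atlas_def all_domains_def)

lemma domain_subset:
  assumes "is_atlas \<sigma> S F \<A>" "s \<in> S" "u \<in> domains \<A> s"
  shows "u \<subseteq> universe (atlas_structure \<A>)"
  using assms by (simp add: is_atlas_def)

lemma chart_dom:
  assumes "is_atlas \<sigma> S F \<A>" "s \<in> S" "u \<in> domains \<A> s"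
  shows "dom (chart \<A> s u) = u"
  using assms by (simp add: is_atlas_def)

lemma chart_bij_betw:
  assumes "is_atlas \<sigma> S F \<A>" "s \<in> S" "u \<in> domains \<A> s"
  shows "bij_betw (the \<circ> chart \<A> s u) u (universe (F s))"
proof -
  have "isomorphism \<sigma> (the \<circ> chart \<A> s u) (induced (atlas_structure \<A>) u) (F s)"
    using assms by (simp add: is_atlas_def)
  moreover have "universe (induced (atlas_structure \<A>) u) = u"
    using domain_subset[OF assms] by (auto simp: induced_def)
  ultimately show ?thesis by (simp add: isomorphism_def)
qed

lemma chart_preserves_and_reflects:
  assumes "is_atlas \<sigma> S F \<A>" "s \<in> S" "u \<in> domains \<A> s"
    and "r \<in> symbols \<sigma>" "length t = arity \<sigma> r" "set t \<subseteq> u"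
  shows "t \<in> interp (atlas_structure \<A>) r \<longleftrightarrow> map (the \<circ> chart \<A> s u) t \<in> interp (F s) r"
proof -
  have "isomorphism \<sigma> (the \<circ> chart \<A> s u) (induced (atlas_structure \<A>) u) (F s)"
    using assms(1-3) by (simp add: is_atlas_def)
  moreover have "set t \<subseteq> universe (induced (atlas_structure \<A>) u)"
    using domain_subset[OF assms(1-3)] assms(6) by (simp add: induced_def)
  ultimately have "t \<in> interp (induced (atlas_structure \<A>) u) r \<longleftrightarrow>
      map (the \<circ> chart \<A> s u) t \<in> interp (F s) r"
    using assms(4,5) unfolding isomorphism_def by blast
  then show ?thesis using assms(6) by (simp add: induced_def)
qed

lemma chart_inj_on:
  assumes "is_atlas \<sigma> S F \<A>" "s \<in> S" "u \<in> domains \<A> s"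
  shows "inj_on (chart \<A> s u) (dom (chart \<A> s u))"
  using bij_betw_imp_inj_on[OF chart_bij_betw[OF assms]] unfolding chart_dom[OF assms]
  by (rule inj_on_imageI2)

lemma chart_change_is_apply:
  assumes "chart_change_is \<A> s u s' u' p" "inj_on (chart \<A> s u) (dom (chart \<A> s u))"
    and "chart \<A> s u y = Some z"
  shows "p z = chart \<A> s' u' y"
  using assms partial_inverse_Some_iff[OF assms(2), of z y]
  by (simp add: chart_change_is_def map_comp_def)

lemma realisation_atlas:
  "is_realisation \<sigma> P \<A> \<Longrightarrow> is_atlas \<sigma> (sites (incidence P)) (site_structure P) \<A>"
  by (simp add: is_realisation_def)

lemma realisation_domains_nonempty:
  "is_realisation \<sigma> P \<A> \<Longrightarrow> s \<in> sites (incidence P) \<Longrightarrow> domains \<A> s \<noteq> {}"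
  by (simp add: is_realisation_def)

lemma realisation_overlap:
  assumes "is_realisation \<sigma> P \<A>" "s \<in> sites (incidence P)" "s' \<in> sites (incidence P)"
    and "u \<in> domains \<A> s" "u' \<in> domains \<A> s'" "u \<inter> u' \<noteq> {}"
  shows "\<exists>w. walk (incidence P) s w s' \<and> chart_change_is \<A> s u s' u' (walk_map P s w)"
  using assms by (simp add: is_realisation_def)

text \<open>For each link in turn, condition (i) on realisations supplies a domain of \<open>\<B>\<close> whose change of
  charts is the transition of that link. The composed map of the walk is only included in the change
  of charts between the two ends, since these domains may share points that are lost on the way.\<close>

lemma walk_followed_in_realisation:
  assumes P: "is_amalgamation_pattern \<sigma> P" and B: "is_realisation \<sigma> P \<B>"
    and "walk (incidence P) s w s'" "v \<in> domains \<B> s"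
  shows "\<exists>v'\<in>domains \<B> s'. \<forall>y z z'.
           chart \<B> s v y = Some z \<and> walk_map P s w z = Some z' \<longrightarrow> chart \<B> s' v' y = Some z'"
  using assms(3,4)
proof (induction w arbitrary: s v)
  case Nil
  then show ?case by (auto simp: restrict_map_def split: if_splits)
next
  case (Cons e w)
  let ?t = "target (incidence P) e"
  from Cons.prems have e: "e \<in> links (incidence P)" "source (incidence P) e = s"
    and w: "walk (incidence P) ?t w s'" by auto
  have sites: "s \<in> sites (incidence P)" "?t \<in> sites (incidence P)"
    using P e by (auto simp: is_amalgamation_pattern_def is_incidence_pattern_def)
  obtain v\<^sub>1 where v\<^sub>1: "v\<^sub>1 \<in> domains \<B> ?t" "chart_change_is \<B> s v ?t v\<^sub>1 (transition P e)"
    using B e sites Cons.prems(2) unfolding is_realisation_def by blast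
  have "inj_on (chart \<B> s v) (dom (chart \<B> s v))"
    by (rule chart_inj_on[OF realisation_atlas[OF B] sites(1) Cons.prems(2)])
  note step = chart_change_is_apply[OF v\<^sub>1(2) this]
  obtain v' where v': "v' \<in> domains \<B> s'"
    "\<And>y z z'. chart \<B> ?t v\<^sub>1 y = Some z \<Longrightarrow> walk_map P ?t w z = Some z' \<Longrightarrow>
       chart \<B> s' v' y = Some z'"
    using Cons.IH[OF w v\<^sub>1(1)] by blast
  have "chart \<B> s' v' y = Some z'"
    if "chart \<B> s v y = Some z" "walk_map P s (e # w) z = Some z'" for y z z'
  proof -
    obtain z\<^sub>1 where "transition P e z = Some z\<^sub>1" "walk_map P ?t w z\<^sub>1 = Some z'"
      using \<open>walk_map P s (e # w) z = Some z'\<close> by (auto simp: map_comp_Some_iff)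
    with step[OF that(1)] show ?thesis using v'(2) by metis
  qed
  with v'(1) show ?case by blast
qed


section \<open>Chart-compatible maps\<close>

definition chart_compatible ::
    "'s set \<Rightarrow> ('r, 'a, 's, 'h) atlas \<Rightarrow> ('r, 'b, 's, 'h) atlas \<Rightarrow> 'a set \<Rightarrow> ('a \<Rightarrow> 'b) \<Rightarrow> bool" where
  "chart_compatible S \<A> \<B> X h \<longleftrightarrow>
     (\<forall>s\<in>S. \<forall>u\<in>domains \<A> s. \<exists>v\<in>domains \<B> s. \<forall>x\<in>u \<inter> X. chart \<B> s v (h x) = chart \<A> s u x)"

lemma chart_compatible_homomorphism:
  assumes A: "is_atlas \<sigma> S F \<A>" and B: "is_atlas \<sigma> S F \<B>"
    and X: "X \<subseteq> universe (atlas_structure \<A>)" and h: "chart_compatible S \<A> \<B> X h"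
  shows "homomorphism \<sigma> h (induced (atlas_structure \<A>) X) (atlas_structure \<B>)"
proof -
  have image: "h ` (u \<inter> X) \<subseteq> v"
    if s: "s \<in> S" and u: "u \<in> domains \<A> s" and v: "v \<in> domains \<B> s"
      and eq: "\<And>x. x \<in> u \<inter> X \<Longrightarrow> chart \<B> s v (h x) = chart \<A> s u x" for s u v
  proof
    fix b assume "b \<in> h ` (u \<inter> X)"
    then obtain x where x: "x \<in> u \<inter> X" "b = h x" by blast
    then have "x \<in> dom (chart \<A> s u)" using chart_dom[OF A s u] by blast
    then have "h x \<in> dom (chart \<B> s v)" using eq[OF x(1)] by (simp add: dom_def)
    then show "b \<in> v" using chart_dom[OF B s v] x(2) by simp
  qed
  have "h x \<in> universe (atlas_structure \<B>)" if x: "x \<in> X" for x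
  proof -
    obtain s u where s: "s \<in> S" and u: "u \<in> domains \<A> s" and xu: "x \<in> u"
      using atlas_covers(1)[OF A] X x by blast
    obtain v where v: "v \<in> domains \<B> s" "\<And>x. x \<in> u \<inter> X \<Longrightarrow> chart \<B> s v (h x) = chart \<A> s u x"
      using h s u unfolding chart_compatible_def by blast
    show ?thesis using image[OF s u v] domain_subset[OF B s v(1)] x xu by blast
  qed
  moreover have "map h t \<in> interp (atlas_structure \<B>) r"
    if r: "r \<in> symbols \<sigma>" and t: "t \<in> interp (atlas_structure \<A>) r" "set t \<subseteq> X" for r t
  proof -
    obtain s u where s: "s \<in> S" and u: "u \<in> domains \<A> s" and tu: "set t \<subseteq> u"
      using atlas_covers(2)[OF A r t(1)] by blast
    obtain v where v: "v \<in> domains \<B> s" "\<And>x. x \<in> u \<inter> X \<Longrightarrow> chart \<B> s v (h x) = chart \<A> s u x"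
      using h s u unfolding chart_compatible_def by blast
    have "is_structure \<sigma> (atlas_structure \<A>)" using A by (simp add: is_atlas_def)
    then have len: "length t = arity \<sigma> r" using r t(1) unfolding is_structure_def by blast
    have "map (the \<circ> chart \<A> s u) t \<in> interp (F s) r"
      using chart_preserves_and_reflects[OF A s u r len tu] t(1) by simp
    moreover have "map (the \<circ> chart \<B> s v) (map h t) = map (the \<circ> chart \<A> s u) t"
      using v(2) tu t(2) by (simp add: subset_iff)
    moreover have "set (map h t) \<subseteq> v" using image[OF s u v] tu t(2) by auto
    ultimately show ?thesis
      using chart_preserves_and_reflects[OF B s v(1) r, of "map h t"] len by (metis length_map)
  qed
  ultimately show ?thesis
    unfolding homomorphism_def induced_def by (simp add: image_subset_iff)
qed

text \<open>The image of \<open>x\<close> is read off in the charts of \<open>u\<^sub>0\<close> and of its counterpart in \<open>\<B>\<close>. Any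
  other domain through \<open>x\<close> meets \<open>X\<close> inside \<open>u\<^sub>0\<close>, so the change of charts from \<open>u\<^sub>0\<close> to it determines its trace completely.\<close>

lemma chart_compatible_extend:
  assumes P: "is_amalgamation_pattern \<sigma> P"
    and A: "is_realisation \<sigma> P \<A>" and B: "is_realisation \<sigma> P \<B>"
    and u\<^sub>0: "u\<^sub>0 \<in> all_domains (sites (incidence P)) \<A>" "x \<in> u\<^sub>0"
    and absorb: "\<And>u. u \<in> all_domains (sites (incidence P)) \<A> \<Longrightarrow> x \<in> u \<Longrightarrow> u \<inter> X \<subseteq> u\<^sub>0"
    and h: "chart_compatible (sites (incidence P)) \<A> \<B> (X - {x}) h"
  shows "\<exists>y. chart_compatible (sites (incidence P)) \<A> \<B> X (h(x := y))"
proof -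
  let ?S = "sites (incidence P)"
  have atlasA: "is_atlas \<sigma> ?S (site_structure P) \<A>" and atlasB: "is_atlas \<sigma> ?S (site_structure P) \<B>"
    by (fact realisation_atlas[OF A] realisation_atlas[OF B])+
  obtain s\<^sub>0 where s\<^sub>0: "s\<^sub>0 \<in> ?S" "u\<^sub>0 \<in> domains \<A> s\<^sub>0" using u\<^sub>0 by (auto simp: all_domains_def)
  obtain v\<^sub>0 where v\<^sub>0: "v\<^sub>0 \<in> domains \<B> s\<^sub>0"
    and h\<^sub>0: "\<And>a. a \<in> u\<^sub>0 \<inter> (X - {x}) \<Longrightarrow> chart \<B> s\<^sub>0 v\<^sub>0 (h a) = chart \<A> s\<^sub>0 u\<^sub>0 a"
    using h s\<^sub>0 unfolding chart_compatible_def by blast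
  have "the (chart \<A> s\<^sub>0 u\<^sub>0 x) \<in> universe (site_structure P s\<^sub>0)"
    using bij_betwE[OF chart_bij_betw[OF atlasA s\<^sub>0]] u\<^sub>0(2) by simp
  then have "the (chart \<A> s\<^sub>0 u\<^sub>0 x) \<in> (the \<circ> chart \<B> s\<^sub>0 v\<^sub>0) ` v\<^sub>0"
    by (simp only: bij_betw_imp_surj_on[OF chart_bij_betw[OF atlasB s\<^sub>0(1) v\<^sub>0]])
  then obtain y where y: "y \<in> v\<^sub>0" "the (chart \<B> s\<^sub>0 v\<^sub>0 y) = the (chart \<A> s\<^sub>0 u\<^sub>0 x)"
    by (elim imageE) simp
  have "x \<in> dom (chart \<A> s\<^sub>0 u\<^sub>0)" "y \<in> dom (chart \<B> s\<^sub>0 v\<^sub>0)"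
    using u\<^sub>0(2) y(1) by (simp_all only: chart_dom[OF atlasA s\<^sub>0] chart_dom[OF atlasB s\<^sub>0(1) v\<^sub>0])
  then have chart_y: "chart \<B> s\<^sub>0 v\<^sub>0 y = chart \<A> s\<^sub>0 u\<^sub>0 x"
    using y(2) by (intro option.expand) auto
  let ?h = "h(x := y)"
  have h': "chart \<B> s\<^sub>0 v\<^sub>0 (?h a) = chart \<A> s\<^sub>0 u\<^sub>0 a" if "a \<in> u\<^sub>0 \<inter> X" for a
    using that h\<^sub>0[of a] chart_y by simp
  have "\<exists>v\<in>domains \<B> s. \<forall>a\<in>u \<inter> X. chart \<B> s v (?h a) = chart \<A> s u a"
    if s: "s \<in> ?S" and u: "u \<in> domains \<A> s" for s u
  proof (cases "x \<in> u")
    case False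
    obtain v where "v \<in> domains \<B> s" "\<forall>a\<in>u \<inter> (X - {x}). chart \<B> s v (h a) = chart \<A> s u a"
      using h s u unfolding chart_compatible_def by blast
    with False show ?thesis by (intro bexI[of _ v]) auto
  next
    case True
    have sub: "u \<inter> X \<subseteq> u\<^sub>0" using absorb[of u] s u True by (auto simp: all_domains_def)
    have "u\<^sub>0 \<inter> u \<noteq> {}" using True u\<^sub>0(2) by blast
    then obtain w where w: "walk (incidence P) s\<^sub>0 w s"
      and change: "chart_change_is \<A> s\<^sub>0 u\<^sub>0 s u (walk_map P s\<^sub>0 w)"
      using realisation_overlap[OF A s\<^sub>0(1) s s\<^sub>0(2) u] by blast
    obtain v where v: "v \<in> domains \<B> s"
      "\<And>b z z'. chart \<B> s\<^sub>0 v\<^sub>0 b = Some z \<Longrightarrow> walk_map P s\<^sub>0 w z = Some z' \<Longrightarrow> chart \<B> s v b = Some z'"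
      using walk_followed_in_realisation[OF P B w v\<^sub>0] by blast
    have "chart \<B> s v (?h a) = chart \<A> s u a" if a: "a \<in> u \<inter> X" for a
    proof -
      have "a \<in> dom (chart \<A> s\<^sub>0 u\<^sub>0)" "a \<in> dom (chart \<A> s u)"
        using a sub unfolding chart_dom[OF atlasA s\<^sub>0] chart_dom[OF atlasA s u] by blast+
      then obtain z z' where z: "chart \<A> s\<^sub>0 u\<^sub>0 a = Some z" and z': "chart \<A> s u a = Some z'"
        by auto
      have "walk_map P s\<^sub>0 w z = Some z'"
        using chart_change_is_apply[OF change chart_inj_on[OF atlasA s\<^sub>0] z] z' by simp
      moreover have "chart \<B> s\<^sub>0 v\<^sub>0 (?h a) = Some z" using h'[of a] a sub z by auto
      ultimately show ?thesis using v(2) z' by metis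
    qed
    with v(1) show ?thesis by blast
  qed
  then show ?thesis unfolding chart_compatible_def by blast
qed

lemma chart_compatible_exists:
  fixes \<A> :: "('r, 'a, 's, 'h) atlas" and \<B> :: "('r, 'b, 's, 'h) atlas"
  assumes P: "is_amalgamation_pattern \<sigma> P"
    and A: "N_acyclic_realisation N \<sigma> P \<A>" and B: "is_realisation \<sigma> P \<B>"
    and "finite X" "X \<subseteq> universe (atlas_structure \<A>)" "card X \<le> N"
  shows "\<exists>h. chart_compatible (sites (incidence P)) \<A> \<B> X h"
  using assms(4-)
proof (induction X rule: finite_psubset_induct)
  case (psubset X)
  let ?S = "sites (incidence P)"
  show ?case
  proof (cases "X = {}")
    case True
    then have "chart_compatible ?S \<A> \<B> X h" for h :: "'a \<Rightarrow> 'b"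
      using realisation_domains_nonempty[OF B] by (auto simp: chart_compatible_def)
    then show ?thesis by blast
  next
    case False
    have realA: "is_realisation \<sigma> P \<A>" using A by (simp add: N_acyclic_realisation_def)
    have "acyclic_hypergraph X (induced_hyperedges (all_domains ?S \<A>) X)"
      using A psubset.prems psubset.hyps
      by (simp add: N_acyclic_realisation_def N_acyclic_hypergraph_def)
    from acyclic_hypergraph_ear[OF this psubset.hyps False]
    obtain x u\<^sub>0 where x: "x \<in> X" and u\<^sub>0: "u\<^sub>0 \<in> all_domains ?S \<A>" "x \<in> u\<^sub>0"
      and absorb: "\<forall>u\<in>all_domains ?S \<A>. x \<in> u \<longrightarrow> u \<inter> X \<subseteq> u\<^sub>0"
      by (elim bexE conjE) (rule that)
    have smaller: "X - {x} \<subset> X" using x by blast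
    have "card (X - {x}) \<le> N" using psubset.prems(2) card_Diff1_le[of X x] by linarith
    then obtain h where "chart_compatible ?S \<A> \<B> (X - {x}) h"
      using psubset.IH[OF smaller] psubset.prems(1) by blast
    from chart_compatible_extend[OF P realA B u\<^sub>0 absorb[rule_format] this] show ?thesis by blast
  qed
qed

theorem proposition4p14:
  fixes N :: nat
    and \<sigma> :: "'r signature"
    and P :: "('r, 'h, 's, 'e) amalgamation_pattern"
    and \<A> :: "('r, 'a, 's, 'h) atlas"
  assumes "3 \<le> N"
    and "finite_signature \<sigma>"
    and "is_amalgamation_pattern \<sigma> P"
    and "N_acyclic_realisation N \<sigma> P \<A>"
  shows "N_universal_realisation TYPE('b) N \<sigma> P \<A>"
  unfolding N_universal_realisation_def
proof (intro conjI allI impI)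
  show real: "is_realisation \<sigma> P \<A>" using assms(4) by (simp add: N_acyclic_realisation_def)
  fix X and \<B> :: "('r, 'b, 's, 'h) atlas"
  assume X: "X \<subseteq> universe (atlas_structure \<A>) \<and> finite X \<and> card X \<le> N"
    and B: "is_realisation \<sigma> P \<B>"
  obtain h where "chart_compatible (sites (incidence P)) \<A> \<B> X h"
    using chart_compatible_exists[OF assms(3,4) B] X by blast
  then show "\<exists>h. homomorphism \<sigma> h (induced (atlas_structure \<A>) X) (atlas_structure \<B>)"
    using chart_compatible_homomorphism[OF realisation_atlas[OF real] realisation_atlas[OF B]] X
    by blast
qed

end
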